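(* Let $(\varphi,\xi,\eta,g)$ be a para-Kenmotsu structure on the $(2n+1)$-dimensional manifold $M$, let $(g,\xi,\lambda,\mu)$ be an $\eta$-Ricci soliton on $M$, and suppose that $(\xi,\cdot)_{R}\cdot S=0$, i.e. $$S(R(\xi,X)Y,Z)+S(Y,R(\xi,X)Z)=0$$ for all vector fields $X,Y,Z$ on $M$. Then $\mu=1$ and $\lambda=2n-1$, so $(M,g)$ is an Einstein manifold (i.e. $S$ is a constant multiple of $g$).
   Context: Here $n\geq 1$. An almost paracontact metric structure on a $(2n+1)$-dimensional smooth manifold $M$ is $(\varphi,\xi,\eta,g)$, where $\varphi$ is a $(1,1)$-tensor field, $\xi$ a vector field, $\eta$ a $1$-form and $g$ a pseudo-Riemannian metric of signature $(n+1,n)$, such that: (1) $\varphi\xi=0$, $\eta\circ\varphi=0$; (2) $\eta(\xi)=1$, $\varphi^2=I-\eta\otimes\xi$; (3) $\varphi$ induces on the $2n$-dimensional distribution $\mathcal{D}=\ker\eta$ an almost paracomplex structure $P$, i.e. $P^2=I$ on $\mathcal{D}$ and the eigensubbundles of $P$ for the eigenvalues $1$ and $-1$ both have rank $n$; (4) $g(\varphi X,\varphi Y)=-g(X,Y)+\eta(X)\eta(Y)$ for all vector fields $X,Y$. It follows that $\eta(X)=g(X,\xi)$. The structure is para-Kenmotsu if the Levi-Civita connection $\nabla$ of $g$ satisfies $(\nabla_X\varphi)Y=g(\varphi X,Y)\xi-\eta(Y)\varphi X$ for all vector fields $X,Y$. $R(X,Y)Z=\nabla_X\nabla_YZ-\nabla_Y\nabla_XZ-\nabla_{[X,Y]}Z$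 is the Riemann curvature tensor, $S(Y,Z)=\operatorname{trace}(X\mapsto R(X,Y)Z)$ is the Ricci curvature tensor of $g$, and $L_\xi$ is the Lie derivative along $\xi$. The data $(g,\xi,\lambda,\mu)$, with $\lambda,\mu$ real constants, is an $\eta$-Ricci soliton on $M$ if $L_{\xi}g+2S+2\lambda g+2\mu\,\eta\otimes\eta=0$. *)

theory Defs
  imports "HOL-Analysis.Analysis" "HOL-Library.Function_Algebras"
begin

text \<open>Pointwise real vector space structure on functions. It is used for tangent vectors (functions
  on \<open>'m \<Rightarrow> real\<close>) and for vector fields.\<close>

instantiation "fun" :: (type, real_vector) real_vector
begin

definition scaleR_fun_def: "scaleR c f = (\<lambda>x. c *\<^sub>R f x)"

instance
  by standard (auto simp: scaleR_fun_def plus_fun_def fun_eq_iff algebra_simps)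

end


section \<open>Linear algebra on subspaces\<close>

definition linear_on :: "'v::real_vector set \<Rightarrow> ('v \<Rightarrow> 'w::real_vector) \<Rightarrow> bool" where
  "linear_on V f \<longleftrightarrow>
     (\<forall>v\<in>V. \<forall>w\<in>V. f (v + w) = f v + f w) \<and> (\<forall>c. \<forall>v\<in>V. f (c *\<^sub>R v) = c *\<^sub>R f v)"

definition sym_bilinear_on :: "'v::real_vector set \<Rightarrow> ('v \<Rightarrow> 'v \<Rightarrow> real) \<Rightarrow> bool" where
  "sym_bilinear_on V b \<longleftrightarrow>
     (\<forall>v\<in>V. linear_on V (b v)) \<and> (\<forall>v\<in>V. \<forall>w\<in>V. b v w = b w v)"

text \<open>Signature \<open>(r, s)\<close>: there is an orthonormal basis with \<open>r\<close> vectors of square \<open>1\<close> and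
  \<open>s\<close> vectors of square \<open>-1\<close>; in particular the form is nondegenerate.\<close>

definition has_signature ::
    "'v::real_vector set \<Rightarrow> ('v \<Rightarrow> 'v \<Rightarrow> real) \<Rightarrow> nat \<Rightarrow> nat \<Rightarrow> bool" where
  "has_signature V b r s \<longleftrightarrow>
     (\<exists>P N. finite P \<and> finite N \<and> P \<inter> N = {} \<and> card P = r \<and> card N = s
        \<and> independent (P \<union> N) \<and> span (P \<union> N) = V
        \<and> (\<forall>v\<in>P \<union> N. \<forall>w\<in>P \<union> N. v \<noteq> w \<longrightarrow> b v w = 0)
        \<and> (\<forall>v\<in>P. b v v = 1) \<and> (\<forall>v\<in>N. b v v = -1))"

text \<open>Trace of an endomorphism of a finite-dimensional subspace \<open>V\<close>: the sum of the diagonal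
  coefficients with respect to a chosen basis (the value does not depend on the choice).\<close>

definition trace_on :: "'v::real_vector set \<Rightarrow> ('v \<Rightarrow> 'v) \<Rightarrow> real" where
  "trace_on V f =
     (let B = (SOME B. B \<subseteq> V \<and> independent B \<and> span B = V)
      in \<Sum>b\<in>B. representation B (f b) b)"

definition almost_paracomplex_on :: "'v::real_vector set \<Rightarrow> nat \<Rightarrow> ('v \<Rightarrow> 'v) \<Rightarrow> bool" where
  "almost_paracomplex_on V n P \<longleftrightarrow>
     linear_on V P \<and> P ` V \<subseteq> V \<and> (\<forall>v\<in>V. P (P v) = v)
     \<and> dim {v\<in>V. P v = v} = n \<and> dim {v\<in>V. P v = - v} = n"


section \<open>Smooth manifolds\<close>

primrec Ck_on :: "nat \<Rightarrow> 'a::real_normed_vector set \<Rightarrow> ('a \<Rightarrow> 'b::real_normed_vector) \<Rightarrow> bool" where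
  "Ck_on 0 U f \<longleftrightarrow> continuous_on U f"
| "Ck_on (Suc k) U f \<longleftrightarrow>
     (\<forall>x\<in>U. f differentiable (at x)) \<and> (\<forall>v. Ck_on k U (\<lambda>x. frechet_derivative f (at x) v))"

text \<open>Infinite differentiability; only used for open \<open>U\<close>.\<close>

definition smooth_on :: "'a::real_normed_vector set \<Rightarrow> ('a \<Rightarrow> 'b::real_normed_vector) \<Rightarrow> bool" where
  "smooth_on U f \<longleftrightarrow> (\<forall>k. Ck_on k U f)"

text \<open>The manifold is the whole (nonempty) type \<open>'m\<close>. In the uses below \<open>'m\<close> is Hausdorff and second
  countable. A chart \<open>(U, x)\<close> consists of its domain and its coordinate map, the latter being
  relevant on \<open>U\<close> only. The dimension of the manifold is \<open>DIM('e)\<close>.\<close>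

type_synonym ('m, 'e) chart = "'m set \<times> ('m \<Rightarrow> 'e)"

definition is_chart :: "('m::topological_space, 'e::euclidean_space) chart \<Rightarrow> bool" where
  "is_chart c \<longleftrightarrow> (case c of (U, x) \<Rightarrow>
     open U \<and> open (x ` U) \<and> homeomorphism U (x ` U) x (inv_into U x))"

definition smooth_atlas :: "('m::topological_space, 'e::euclidean_space) chart set \<Rightarrow> bool" where
  "smooth_atlas A \<longleftrightarrow>
     (\<forall>c\<in>A. is_chart c) \<and> (\<Union>(U, x)\<in>A. U) = UNIV
     \<and> (\<forall>(U, x)\<in>A. \<forall>(V, y)\<in>A. smooth_on (x ` (U \<inter> V)) (y \<circ> inv_into U x))"

definition smooth_funs ::
    "('m::topological_space, 'e::euclidean_space) chart set \<Rightarrow> ('m \<Rightarrow> real) set" where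
  "smooth_funs A = {f. \<forall>(U, x)\<in>A. smooth_on (x ` U) (f \<circ> inv_into U x)}"

text \<open>Tangent vectors at \<open>p\<close> are the derivations at \<open>p\<close> of the algebra of smooth functions. As HOL
  functions are total, a derivation is extended by \<open>0\<close> to the non-smooth functions, so that it is
  determined by its values on smooth functions and the tangent space is a linear subspace.\<close>

type_synonym 'm tangent = "('m \<Rightarrow> real) \<Rightarrow> real"

definition tangent_space ::
    "('m::topological_space, 'e::euclidean_space) chart set \<Rightarrow> 'm \<Rightarrow> 'm tangent set" where
  "tangent_space A p =
     {v. linear_on (smooth_funs A) v
       \<and> (\<forall>f\<in>smooth_funs A. \<forall>g\<in>smooth_funs A. v (\<lambda>q. f q * g q) = f p * v g + g p * v f)
       \<and> (\<forall>f. f \<notin> smooth_funs A \<longrightarrow> v f = 0)}"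

type_synonym 'm vfield = "'m \<Rightarrow> 'm tangent"

definition vector_fields ::
    "('m::topological_space, 'e::euclidean_space) chart set \<Rightarrow> 'm vfield set" where
  "vector_fields A =
     {X. (\<forall>p. X p \<in> tangent_space A p) \<and> (\<forall>f\<in>smooth_funs A. (\<lambda>p. X p f) \<in> smooth_funs A)}"

definition lie_bracket ::
    "('m::topological_space, 'e::euclidean_space) chart set \<Rightarrow> 'm vfield \<Rightarrow> 'm vfield \<Rightarrow> 'm vfield" where
  "lie_bracket A X Y = (\<lambda>p f. if f \<in> smooth_funs A
      then X p (\<lambda>q. Y q f) - Y p (\<lambda>q. X q f) else 0)"


section \<open>Tensor fields\<close>

definition one_form ::
    "('m::topological_space, 'e::euclidean_space) chart set \<Rightarrow> ('m \<Rightarrow> 'm tangent \<Rightarrow> real) \<Rightarrow> bool" where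
  "one_form A \<eta> \<longleftrightarrow>
     (\<forall>p. linear_on (tangent_space A p) (\<eta> p))
     \<and> (\<forall>X\<in>vector_fields A. (\<lambda>p. \<eta> p (X p)) \<in> smooth_funs A)"

text \<open>\<open>(1,1)\<close>-tensor fields, as smooth fields of endomorphisms of the tangent spaces.\<close>

definition endo_field ::
    "('m::topological_space, 'e::euclidean_space) chart set \<Rightarrow> ('m \<Rightarrow> 'm tangent \<Rightarrow> 'm tangent) \<Rightarrow> bool" where
  "endo_field A \<phi> \<longleftrightarrow>
     (\<forall>p. linear_on (tangent_space A p) (\<phi> p) \<and> \<phi> p ` tangent_space A p \<subseteq> tangent_space A p)
     \<and> (\<forall>X\<in>vector_fields A. (\<lambda>p. \<phi> p (X p)) \<in> vector_fields A)"

definition pseudo_riemannian_metric ::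
    "('m::topological_space, 'e::euclidean_space) chart set \<Rightarrow> nat \<Rightarrow> nat
      \<Rightarrow> ('m \<Rightarrow> 'm tangent \<Rightarrow> 'm tangent \<Rightarrow> real) \<Rightarrow> bool" where
  "pseudo_riemannian_metric A r s g \<longleftrightarrow>
     (\<forall>p. sym_bilinear_on (tangent_space A p) (g p) \<and> has_signature (tangent_space A p) (g p) r s)
     \<and> (\<forall>X\<in>vector_fields A. \<forall>Y\<in>vector_fields A. (\<lambda>p. g p (X p) (Y p)) \<in> smooth_funs A)"

text \<open>\<open>(L\<^bsub>Z\<^esub> g)(X, Y) = Z(g(X, Y)) - g([Z, X], Y) - g(X, [Z, Y])\<close>\<close>

definition lie_derivative_metric ::
    "('m::topological_space, 'e::euclidean_space) chart set \<Rightarrow> 'm vfield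
      \<Rightarrow> ('m \<Rightarrow> 'm tangent \<Rightarrow> 'm tangent \<Rightarrow> real) \<Rightarrow> 'm vfield \<Rightarrow> 'm vfield \<Rightarrow> 'm \<Rightarrow> real" where
  "lie_derivative_metric A Z g X Y = (\<lambda>p.
     Z p (\<lambda>q. g q (X q) (Y q))
     - g p (lie_bracket A Z X p) (Y p) - g p (X p) (lie_bracket A Z Y p))"


section \<open>Connections and curvature\<close>

definition affine_connection ::
    "('m::topological_space, 'e::euclidean_space) chart set \<Rightarrow> ('m vfield \<Rightarrow> 'm vfield \<Rightarrow> 'm vfield) \<Rightarrow> bool" where
  "affine_connection A D \<longleftrightarrow>
     (\<forall>X\<in>vector_fields A. \<forall>Y\<in>vector_fields A. D X Y \<in> vector_fields A)
     \<and> (\<forall>X\<in>vector_fields A. \<forall>Y\<in>vector_fields A. \<forall>Z\<in>vector_fields A. D (X + Y) Z = D X Z + D Y Z)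
     \<and> (\<forall>f\<in>smooth_funs A. \<forall>X\<in>vector_fields A. \<forall>Y\<in>vector_fields A.
          D (\<lambda>p. f p *\<^sub>R X p) Y = (\<lambda>p. f p *\<^sub>R D X Y p))
     \<and> (\<forall>X\<in>vector_fields A. linear_on (vector_fields A) (D X))
     \<and> (\<forall>f\<in>smooth_funs A. \<forall>X\<in>vector_fields A. \<forall>Y\<in>vector_fields A.
          D X (\<lambda>p. f p *\<^sub>R Y p) = (\<lambda>p. X p f *\<^sub>R Y p + f p *\<^sub>R D X Y p))"

definition levi_civita ::
    "('m::topological_space, 'e::euclidean_space) chart set \<Rightarrow> ('m \<Rightarrow> 'm tangent \<Rightarrow> 'm tangent \<Rightarrow> real)
      \<Rightarrow> ('m vfield \<Rightarrow> 'm vfield \<Rightarrow> 'm vfield) \<Rightarrow> bool" where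
  "levi_civita A g D \<longleftrightarrow>
     affine_connection A D
     \<and> (\<forall>X\<in>vector_fields A. \<forall>Y\<in>vector_fields A. D X Y - D Y X = lie_bracket A X Y)
     \<and> (\<forall>X\<in>vector_fields A. \<forall>Y\<in>vector_fields A. \<forall>Z\<in>vector_fields A. \<forall>p.
          X p (\<lambda>q. g q (Y q) (Z q)) = g p (D X Y p) (Z p) + g p (Y p) (D X Z p))"

definition curvature ::
    "('m::topological_space, 'e::euclidean_space) chart set \<Rightarrow> ('m vfield \<Rightarrow> 'm vfield \<Rightarrow> 'm vfield)
      \<Rightarrow> 'm vfield \<Rightarrow> 'm vfield \<Rightarrow> 'm vfield \<Rightarrow> 'm vfield" where
  "curvature A D X Y Z = D X (D Y Z) - D Y (D X Z) - D (lie_bracket A X Y) Z"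

text \<open>\<open>S(Y, Z)\<close> at \<open>p\<close> is the trace of the endomorphism \<open>x \<mapsto> R(x, Y)Z\<close> of the tangent space at \<open>p\<close>.
  As the curvature is defined on vector fields, \<open>x\<close> is first extended to a vector field; the
  curvature being a tensor, the choice is immaterial.\<close>

definition ricci ::
    "('m::topological_space, 'e::euclidean_space) chart set \<Rightarrow> ('m vfield \<Rightarrow> 'm vfield \<Rightarrow> 'm vfield)
      \<Rightarrow> 'm vfield \<Rightarrow> 'm vfield \<Rightarrow> 'm \<Rightarrow> real" where
  "ricci A D Y Z = (\<lambda>p. trace_on (tangent_space A p)
     (\<lambda>x. curvature A D (SOME X. X \<in> vector_fields A \<and> X p = x) Y Z p))"

definition einstein ::
    "('m::topological_space, 'e::euclidean_space) chart set \<Rightarrow> ('m \<Rightarrow> 'm tangent \<Rightarrow> 'm tangent \<Rightarrow> real)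
      \<Rightarrow> ('m vfield \<Rightarrow> 'm vfield \<Rightarrow> 'm vfield) \<Rightarrow> bool" where
  "einstein A g D \<longleftrightarrow>
     (\<exists>c. \<forall>X\<in>vector_fields A. \<forall>Y\<in>vector_fields A. \<forall>p. ricci A D X Y p = c * g p (X p) (Y p))"


section \<open>Para-Kenmotsu structures and \<open>\<eta>\<close>-Ricci solitons\<close>

definition almost_paracontact_metric ::
    "('m::topological_space, 'e::euclidean_space) chart set \<Rightarrow> nat
      \<Rightarrow> ('m \<Rightarrow> 'm tangent \<Rightarrow> 'm tangent) \<Rightarrow> 'm vfield \<Rightarrow> ('m \<Rightarrow> 'm tangent \<Rightarrow> real)
      \<Rightarrow> ('m \<Rightarrow> 'm tangent \<Rightarrow> 'm tangent \<Rightarrow> real) \<Rightarrow> bool" where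
  "almost_paracontact_metric A n \<phi> \<xi> \<eta> g \<longleftrightarrow>
     endo_field A \<phi> \<and> \<xi> \<in> vector_fields A \<and> one_form A \<eta> \<and> pseudo_riemannian_metric A (n + 1) n g
     \<and> (\<forall>p. \<phi> p (\<xi> p) = 0 \<and> (\<forall>v\<in>tangent_space A p. \<eta> p (\<phi> p v) = 0))
     \<and> (\<forall>p. \<eta> p (\<xi> p) = 1 \<and> (\<forall>v\<in>tangent_space A p. \<phi> p (\<phi> p v) = v - \<eta> p v *\<^sub>R \<xi> p))
     \<and> (\<forall>p. almost_paracomplex_on {v\<in>tangent_space A p. \<eta> p v = 0} n (\<phi> p))
     \<and> (\<forall>X\<in>vector_fields A. \<forall>Y\<in>vector_fields A. \<forall>p.
          g p (\<phi> p (X p)) (\<phi> p (Y p)) = - g p (X p) (Y p) + \<eta> p (X p) * \<eta> p (Y p))"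

text \<open>The last condition is \<open>(\<nabla>\<^bsub>X\<^esub> \<phi>) Y = g(\<phi> X, Y) \<xi> - \<eta>(Y) \<phi> X\<close>, where
  \<open>(\<nabla>\<^bsub>X\<^esub> \<phi>) Y = \<nabla>\<^bsub>X\<^esub> (\<phi> Y) - \<phi> (\<nabla>\<^bsub>X\<^esub> Y)\<close> and \<open>D\<close> stands for \<open>\<nabla>\<close>.\<close>

definition para_kenmotsu ::
    "('m::topological_space, 'e::euclidean_space) chart set \<Rightarrow> nat
      \<Rightarrow> ('m \<Rightarrow> 'm tangent \<Rightarrow> 'm tangent) \<Rightarrow> 'm vfield \<Rightarrow> ('m \<Rightarrow> 'm tangent \<Rightarrow> real)
      \<Rightarrow> ('m \<Rightarrow> 'm tangent \<Rightarrow> 'm tangent \<Rightarrow> real) \<Rightarrow> ('m vfield \<Rightarrow> 'm vfield \<Rightarrow> 'm vfield) \<Rightarrow> bool" where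
  "para_kenmotsu A n \<phi> \<xi> \<eta> g D \<longleftrightarrow>
     almost_paracontact_metric A n \<phi> \<xi> \<eta> g \<and> levi_civita A g D
     \<and> (\<forall>X\<in>vector_fields A. \<forall>Y\<in>vector_fields A. \<forall>p.
          D X (\<lambda>q. \<phi> q (Y q)) p - \<phi> p (D X Y p)
            = g p (\<phi> p (X p)) (Y p) *\<^sub>R \<xi> p - \<eta> p (Y p) *\<^sub>R \<phi> p (X p))"

definition eta_ricci_soliton ::
    "('m::topological_space, 'e::euclidean_space) chart set \<Rightarrow> ('m \<Rightarrow> 'm tangent \<Rightarrow> real)
      \<Rightarrow> ('m vfield \<Rightarrow> 'm vfield \<Rightarrow> 'm vfield) \<Rightarrow> ('m \<Rightarrow> 'm tangent \<Rightarrow> 'm tangent \<Rightarrow> real)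
      \<Rightarrow> 'm vfield \<Rightarrow> real \<Rightarrow> real \<Rightarrow> bool" where
  "eta_ricci_soliton A \<eta> D g \<xi> l m \<longleftrightarrow>
     (\<forall>X\<in>vector_fields A. \<forall>Y\<in>vector_fields A. \<forall>p.
        lie_derivative_metric A \<xi> g X Y p + 2 * ricci A D X Y p
          + 2 * l * g p (X p) (Y p) + 2 * m * (\<eta> p (X p) * \<eta> p (Y p)) = 0)"

end

theory Submission
  imports Defs
begin

text \<open>On a para-Kenmotsu manifold \<open>\<nabla>\<^bsub>X\<^esub> \<xi> = X - \<eta>(X) \<xi>\<close> and \<open>d\<eta> = 0\<close>, hence
  \<open>R(X, Y) \<xi> = \<eta>(X) Y - \<eta>(Y) X\<close>, and taking the trace \<open>S(Y, \<xi>) = -2n \<eta>(Y)\<close>. The soliton equation reads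
  \<open>S = -(1 + \<lambda>) g + (1 - \<mu>) \<eta> \<otimes> \<eta>\<close>, which at \<open>(\<xi>, \<xi>)\<close> gives \<open>\<lambda> + \<mu> = 2n\<close>. For \<open>Z = \<xi>\<close>
  the hypothesis on \<open>S\<close>, together with the skew-symmetry of \<open>R(\<xi>, X)\<close>, becomes
  \<open>(2n - 1 - \<lambda>)(g(X, Y) - \<eta>(X) \<eta>(Y)) = 0\<close>; a vector of square \<open>-1\<close> makes the second factor
  nonzero. Bump functions are needed to extend tangent vectors to vector fields, so that the trace
  defining \<open>S\<close> and this last choice make sense.\<close>

section \<open>Calculus of \<open>C\<^sup>k\<close> functions\<close>

lemma Ck_on_subset: "Ck_on k U f \<Longrightarrow> V \<subseteq> U \<Longrightarrow> Ck_on k V f"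
  by (induction k arbitrary: f) (auto intro: continuous_on_subset)

text \<open>Functions are total but only their values on U are controlled. As U is open, agreement
  on U forces equal derivatives at the points of U, so the induction can pass to them.\<close>

lemma Ck_on_cong:
  assumes "open U" "Ck_on k U f" "\<And>x. x \<in> U \<Longrightarrow> f x = g x"
  shows "Ck_on k U g"
  using assms(2,3)
proof (induction k arbitrary: f g)
  case 0
  then show ?case by (simp cong: continuous_on_cong)
next
  case (Suc k)
  have *: "(g has_derivative frechet_derivative f (at x)) (at x)" if "x \<in> U" for x
  proof (rule has_derivative_transform_within_open[OF _ assms(1) that Suc.prems(2)])
    show "(f has_derivative frechet_derivative f (at x)) (at x)"
      using Suc.prems(1) that by (simp flip: frechet_derivative_works)
  qed
  have "Ck_on k U (\<lambda>x. frechet_derivative g (at x) v)" for v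
  proof (rule Suc.IH)
    show "Ck_on k U (\<lambda>x. frechet_derivative f (at x) v)"
      using Suc.prems(1) by simp
  qed (simp add: frechet_derivative_at[OF *])
  then show ?case using * by (auto simp: differentiable_def)
qed

text \<open>By uniqueness of derivatives, an explicit formula f' may replace
  \<open>frechet_derivative\<close>; the product and chain rules below enter in this form.\<close>

lemma Ck_on_SucI:
  assumes "open U" "\<And>x. x \<in> U \<Longrightarrow> (f has_derivative f' x) (at x)"
    and "\<And>v. Ck_on k U (\<lambda>x. f' x v)"
  shows "Ck_on (Suc k) U f"
proof -
  have "Ck_on k U (\<lambda>x. frechet_derivative f (at x) v)" for v
    by (rule Ck_on_cong[OF assms(1) assms(3)[of v]]) (rule fun_cong[OF frechet_derivative_at[OF assms(2)]])
  then show ?thesis using assms(2) by (auto simp: differentiable_def)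
qed

lemma Ck_on_SucD:
  assumes "Ck_on (Suc k) U f"
  shows "x \<in> U \<Longrightarrow> (f has_derivative frechet_derivative f (at x)) (at x)"
    and "Ck_on k U (\<lambda>x. frechet_derivative f (at x) v)"
  using assms by (simp_all flip: frechet_derivative_works)

text \<open>The derivatives of products and compositions contain undifferentiated factors; for these
  the induction has to give up one order of smoothness.\<close>

lemma Ck_on_Suc_imp: "Ck_on (Suc k) U f \<Longrightarrow> Ck_on k U f"
proof (induction k arbitrary: f)
  case 0
  then have "f differentiable_on U"
    by (simp add: differentiable_at_withinI differentiable_on_def)
  then show ?case by (simp add: differentiable_imp_continuous_on)
next
  case (Suc k)
  then have "Ck_on (Suc k) U (\<lambda>x. frechet_derivative f (at x) v)" for v by simp
  then have "Ck_on k U (\<lambda>x. frechet_derivative f (at x) v)" for v by (rule Suc.IH)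
  then show ?case using Suc.prems by simp
qed

lemma Ck_on_Un:
  assumes "open U" "open V" "Ck_on k U f" "Ck_on k V f"
  shows "Ck_on k (U \<union> V) f"
  using assms(3,4)
  by (induction k arbitrary: f) (auto intro: continuous_on_open_Un[OF assms(1,2)])

lemma Ck_on_const: "open U \<Longrightarrow> Ck_on k U (\<lambda>x. c)"
proof (induction k arbitrary: c)
  case (Suc k)
  then show ?case by (intro Ck_on_SucI[where f' = "\<lambda>_ _. 0"]) auto
qed simp

lemma Ck_on_add:
  assumes "open U" "Ck_on k U f" "Ck_on k U g"
  shows "Ck_on k U (\<lambda>x. f x + g x)"
  using assms(2,3)
proof (induction k arbitrary: f g)
  case (Suc k)
  show ?case
    using Ck_on_SucD[OF Suc.prems(1)] Ck_on_SucD[OF Suc.prems(2)]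
    by (intro Ck_on_SucI[OF assms(1), where
          f' = "\<lambda>x v. frechet_derivative f (at x) v + frechet_derivative g (at x) v"])
       (auto intro!: has_derivative_add Suc.IH)
qed (auto intro: continuous_on_add)

lemma Ck_on_sum:
  assumes "open U" "finite I" "\<And>i. i \<in> I \<Longrightarrow> Ck_on k U (f i)"
  shows "Ck_on k U (\<lambda>x. \<Sum>i\<in>I. f i x)"
  using assms(2,3) by (induction I) (auto intro: Ck_on_const Ck_on_add assms(1))

lemma Ck_on_bounded_linear_comp:
  assumes "open U" "bounded_linear h" "Ck_on k U f"
  shows "Ck_on k U (\<lambda>x. h (f x))"
  using assms(3)
proof (induction k arbitrary: f)
  case 0
  then show ?case using bounded_linear.continuous_on[OF assms(2)] by simp
next
  case (Suc k)
  show ?case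
    using Ck_on_SucD[OF Suc.prems]
    by (intro Ck_on_SucI[OF assms(1), where f' = "\<lambda>x v. h (frechet_derivative f (at x) v)"])
       (auto intro!: bounded_linear.has_derivative[OF assms(2)] Suc.IH)
qed

lemma Ck_on_bounded_linear:
  assumes "open U" "bounded_linear h"
  shows "Ck_on k U h"
proof (cases k)
  case 0
  then show ?thesis using linear_continuous_on[OF assms(2)] by simp
next
  case (Suc j)
  have "Ck_on (Suc j) U h"
    by (rule Ck_on_SucI[OF assms(1), where f' = "\<lambda>_. h"])
       (auto intro: bounded_linear_imp_has_derivative assms Ck_on_const)
  then show ?thesis using Suc by simp
qed

lemma Ck_on_mult:
  fixes f g :: "'a::real_normed_vector \<Rightarrow> real"
  assumes "open U" "Ck_on k U f" "Ck_on k U g"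
  shows "Ck_on k U (\<lambda>x. f x * g x)"
  using assms(2,3)
proof (induction k arbitrary: f g)
  case (Suc k)
  show ?case
    using Ck_on_SucD[OF Suc.prems(1)] Ck_on_SucD[OF Suc.prems(2)] Suc.prems[THEN Ck_on_Suc_imp]
    by (intro Ck_on_SucI[OF assms(1), where
          f' = "\<lambda>x v. f x * frechet_derivative g (at x) v + frechet_derivative f (at x) v * g x"])
       (auto intro!: has_derivative_mult Suc.IH Ck_on_add assms(1))
qed (auto intro: continuous_on_mult)

text \<open>In f'(h x)(h'(x) v) the direction h'(x) v varies with x, whereas \<open>Ck_on\<close>
  speaks of fixed directions. Expanding it over \<open>Basis\<close> leaves products of components
  of h'(x) v with directional derivatives of f composed with h, and these fall under the induction
  hypothesis.\<close>

lemma Ck_on_compose: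
  fixes f :: "'e::euclidean_space \<Rightarrow> real"
  assumes "open U" "open V" "h ` U \<subseteq> V" "Ck_on k V f" "Ck_on k U h"
  shows "Ck_on k U (\<lambda>x. f (h x))"
  using assms(4,5)
proof (induction k arbitrary: f)
  case 0
  then show ?case using assms(3) by (auto intro: continuous_on_compose2)
next
  case (Suc k)
  let ?f' = "\<lambda>y. frechet_derivative f (at y)" and ?h' = "\<lambda>x. frechet_derivative h (at x)"
  have f': "(f has_derivative ?f' (h x)) (at (h x))" if "x \<in> U" for x
    using that Suc.prems(1) assms(3) by (intro Ck_on_SucD) auto
  have h': "(h has_derivative ?h' x) (at x)" if "x \<in> U" for x
    using that Suc.prems(2) by (rule Ck_on_SucD(1)[rotated])
  show ?case
  proof (rule Ck_on_SucI[OF assms(1), where f' = "\<lambda>x v. \<Sum>i\<in>Basis. (?h' x v \<bullet> i) * ?f' (h x) i"])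
    fix x assume x: "x \<in> U"
    have "((\<lambda>x. f (h x)) has_derivative (\<lambda>v. ?f' (h x) (?h' x v))) (at x)"
      using has_derivative_compose[OF h'[OF x] f'[OF x]] .
    then show "((\<lambda>x. f (h x)) has_derivative (\<lambda>v. \<Sum>i\<in>Basis. (?h' x v \<bullet> i) * ?f' (h x) i)) (at x)"
    proof (rule has_derivative_eq_rhs, intro ext)
      fix v
      interpret linear "?f' (h x)" using f'[OF x] by (rule has_derivative_linear)
      have "?f' (h x) (\<Sum>i\<in>Basis. (?h' x v \<bullet> i) *\<^sub>R i) = (\<Sum>i\<in>Basis. (?h' x v \<bullet> i) * ?f' (h x) i)"
        by (simp add: sum scale)
      then show "?f' (h x) (?h' x v) = (\<Sum>i\<in>Basis. (?h' x v \<bullet> i) * ?f' (h x) i)"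
        by (simp add: euclidean_representation)
    qed
  next
    fix v
    have "Ck_on k U (\<lambda>x. ?f' (h x) i)" for i
      by (rule Suc.IH[OF Ck_on_SucD(2)[OF Suc.prems(1)] Ck_on_Suc_imp[OF Suc.prems(2)]])
    moreover have "Ck_on k U (\<lambda>x. ?h' x v \<bullet> i)" for i
      using Ck_on_SucD(2)[OF Suc.prems(2)]
      by (intro Ck_on_bounded_linear_comp[OF assms(1) bounded_linear_inner_left])
    ultimately show "Ck_on k U (\<lambda>x. \<Sum>i\<in>Basis. (?h' x v \<bullet> i) * ?f' (h x) i)"
      using assms(1) by (intro Ck_on_sum Ck_on_mult) auto
  qed
qed

section \<open>A smooth bump function\<close>

text \<open>The family is closed under differentiation up to linear combinations, which makes the
  smoothness of its member \<open>k = 0\<close> an induction over the whole family.\<close>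

definition bump_fun :: "nat \<Rightarrow> real \<Rightarrow> real" where
  "bump_fun k t = (if t > 0 then exp (- (1 / t)) / t ^ k else 0)"

text \<open>From the right, the substitution x = 1/t turns this into the limit of x^k / exp x at
  infinity.\<close>

lemma bump_fun_tendsto_0: "(bump_fun k \<longlongrightarrow> 0) (at 0)"
proof -
  have "((\<lambda>t::real. exp (- (1 / t)) / t ^ k) \<longlongrightarrow> 0) (at_right 0)"
  proof -
    have "((\<lambda>x::real. x ^ k / exp x) \<longlongrightarrow> 0) at_top" by (rule tendsto_power_div_exp_0)
    then have "((\<lambda>t::real. inverse t ^ k / exp (inverse t)) \<longlongrightarrow> 0) (at_right 0)"
      by (rule filterlim_compose[OF _ filterlim_inverse_at_top_right])
    then show ?thesis by (simp add: field_simps exp_minus inverse_eq_divide)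
  qed
  then have "(bump_fun k \<longlongrightarrow> 0) (at_right 0)"
    by (rule Lim_transform_eventually)
       (auto simp: bump_fun_def eventually_at_filter intro: always_eventually)
  moreover have "(bump_fun k \<longlongrightarrow> 0) (at_left 0)"
    by (rule Lim_transform_eventually[OF tendsto_const])
       (auto simp: bump_fun_def eventually_at_filter intro: always_eventually)
  ultimately show ?thesis by (simp add: filterlim_at_split)
qed

lemma bump_fun_has_derivative:
  "(bump_fun k has_real_derivative bump_fun (k + 2) t - real k * bump_fun (k + 1) t) (at t)"
proof -
  consider "t < 0" | "t = 0" | "t > 0" by linarith
  then show ?thesis
  proof cases
    case 1
    have "((\<lambda>_. 0) has_real_derivative 0) (at t)" by simp
    then have "(bump_fun k has_real_derivative 0) (at t)"
      by (rule has_field_derivative_transform_within_open[where S = "{..<0}"])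
         (use 1 in \<open>auto simp: bump_fun_def\<close>)
    then show ?thesis using 1 by (simp add: bump_fun_def)
  next
    case 2
    \<comment> \<open>Dividing by h raises the exponent of the denominator by one, so the difference
      quotient at 0 is the next member of the family, which tends to 0.\<close>
    have "(bump_fun k (0 + h) - bump_fun k 0) / h = bump_fun (Suc k) h" for h
      by (simp add: bump_fun_def mult.commute)
    then have "((\<lambda>h. (bump_fun k (0 + h) - bump_fun k 0) / h) \<longlongrightarrow> 0) (at 0)"
      using bump_fun_tendsto_0[of "Suc k"] by simp
    then show ?thesis using 2 by (simp add: DERIV_def bump_fun_def)
  next
    case 3
    have "((\<lambda>t. exp (- (1 / t)) / t ^ k) has_real_derivative
        bump_fun (k + 2) t - real k * bump_fun (k + 1) t) (at t)"
    proof (rule DERIV_cong)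
      show "((\<lambda>t. exp (- (1 / t)) / t ^ k) has_real_derivative
          (exp (- (1 / t)) * (1 / t\<^sup>2) * t ^ k - exp (- (1 / t)) * (real k * t ^ (k - 1))) / (t ^ k * t ^ k)) (at t)"
        using 3 by (auto intro!: derivative_eq_intros simp: power2_eq_square)
      \<comment> \<open>For k = 0 the truncated exponent k - 1 is harmless: the factor
        \<open>real k\<close> makes both sides 0.\<close>
      have *: "real k * t ^ (k - 1) = real k * t ^ k / t"
        using 3 by (cases k) auto
      show "(exp (- (1 / t)) * (1 / t\<^sup>2) * t ^ k - exp (- (1 / t)) * (real k * t ^ (k - 1))) / (t ^ k * t ^ k)
          = bump_fun (k + 2) t - real k * bump_fun (k + 1) t"
        unfolding * using 3 by (simp add: bump_fun_def field_simps power2_eq_square)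
    qed
    then show ?thesis
      by (rule has_field_derivative_transform_within_open[where S = "{0<..}"])
         (use 3 in \<open>auto simp: bump_fun_def\<close>)
  qed
qed

lemma Ck_on_bump_fun: "Ck_on j UNIV (bump_fun k)"
proof (induction j arbitrary: k)
  case 0
  have "isCont (bump_fun k) t" for t
    using bump_fun_has_derivative by (rule DERIV_isCont)
  then show ?case by (simp add: continuous_at_imp_continuous_on)
next
  case (Suc j)
  show ?case
  proof (rule Ck_on_SucI[OF open_UNIV, where
        f' = "\<lambda>t v. v * (bump_fun (k + 2) t + (- real k) * bump_fun (k + 1) t)"])
    fix t
    show "(bump_fun k has_derivative
        (\<lambda>v. v * (bump_fun (k + 2) t + (- real k) * bump_fun (k + 1) t))) (at t)"
      using bump_fun_has_derivative[of k t] by (simp add: has_field_derivative_def mult.commute[of _ "_ - _"])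
  qed (intro Ck_on_mult Ck_on_add Ck_on_const Suc.IH open_UNIV)
qed

text \<open>The argument of \<open>bump_fun 0\<close> is positive exactly where |z - a| < |r|, so
  this is a smooth bump living on a ball.\<close>

lemma Ck_on_ball_bump:
  fixes a :: "'e::euclidean_space"
  shows "Ck_on k UNIV (\<lambda>z. bump_fun 0 (r\<^sup>2 - (z - a) \<bullet> (z - a)))"
proof (rule Ck_on_compose[OF open_UNIV open_UNIV _ Ck_on_bump_fun])
  have lin: "Ck_on k UNIV (\<lambda>z. (z - a) \<bullet> i)" for i
  proof -
    have "Ck_on k UNIV (\<lambda>z. z \<bullet> i + (- (a \<bullet> i)))"
      by (intro Ck_on_add Ck_on_const Ck_on_bounded_linear open_UNIV bounded_linear_inner_left)
    then show ?thesis by (simp add: inner_diff_left)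
  qed
  \<comment> \<open>In coordinates the squared norm is a polynomial in affine functions, within
    reach of the rules for sums and products.\<close>
  have "Ck_on k UNIV (\<lambda>z. r\<^sup>2 + (-1) * (\<Sum>i\<in>Basis. ((z - a) \<bullet> i) * ((z - a) \<bullet> i)))"
    by (intro Ck_on_add Ck_on_mult Ck_on_sum Ck_on_const lin open_UNIV finite_Basis)
  moreover have "r\<^sup>2 + (-1) * (\<Sum>i\<in>Basis. ((z - a) \<bullet> i) * ((z - a) \<bullet> i)) = r\<^sup>2 - (z - a) \<bullet> (z - a)" for z
    unfolding euclidean_inner[of "z - a" "z - a"] by linarith
  ultimately show "Ck_on k UNIV (\<lambda>z. r\<^sup>2 - (z - a) \<bullet> (z - a))"
    by (simp only:)
qed simp

section \<open>Extension of tangent vectors to vector fields\<close>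

lemma linear_onD:
  assumes "linear_on V f"
  shows "v \<in> V \<Longrightarrow> w \<in> V \<Longrightarrow> f (v + w) = f v + f w" "v \<in> V \<Longrightarrow> f (c *\<^sub>R v) = c *\<^sub>R f v"
  using assms by (auto simp: linear_on_def)

lemma linear_on_zero: "linear_on V f \<Longrightarrow> subspace V \<Longrightarrow> f 0 = 0"
  using linear_onD(2)[of V f 0 0] subspace_0 by force

lemma linear_on_diff:
  assumes "linear_on V f" "subspace V" "v \<in> V" "w \<in> V"
  shows "f (v - w) = f v - f w"
  using linear_onD(1)[OF assms(1,3), of "- 1 *\<^sub>R w"] linear_onD(2)[OF assms(1,4), of "- 1"]
    subspace_neg[OF assms(2,4)] by simp

lemma linear_on_sum:
  assumes "linear_on V f" "subspace V" "\<And>i. i \<in> I \<Longrightarrow> v i \<in> V"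
  shows "f (sum v I) = (\<Sum>i\<in>I. f (v i))"
  using assms(3)
  by (induction I rule: infinite_finite_induct)
     (auto simp: linear_on_zero[OF assms(1,2)] linear_onD(1)[OF assms(1)] subspace_sum[OF assms(2)])

lemma smooth_funsD: "f \<in> smooth_funs A \<Longrightarrow> (U, x) \<in> A \<Longrightarrow> Ck_on k (x ` U) (f \<circ> inv_into U x)"
  by (auto simp: smooth_funs_def smooth_on_def)

lemma smooth_funsI:
  "(\<And>U x k. (U, x) \<in> A \<Longrightarrow> Ck_on k (x ` U) (f \<circ> inv_into U x)) \<Longrightarrow> f \<in> smooth_funs A"
  by (auto simp: smooth_funs_def smooth_on_def)

lemma tangent_spaceD:
  assumes "v \<in> tangent_space A p"
  shows "linear_on (smooth_funs A) v"
    and "f \<in> smooth_funs A \<Longrightarrow> h \<in> smooth_funs A \<Longrightarrow> v (\<lambda>q. f q * h q) = f p * v h + h p * v f"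
  using assms by (auto simp: tangent_space_def)

lemma vector_fieldsD:
  assumes "X \<in> vector_fields A"
  shows "X p \<in> tangent_space A p"
    and "f \<in> smooth_funs A \<Longrightarrow> (\<lambda>p. X p f) \<in> smooth_funs A"
  using assms by (auto simp: vector_fields_def)

lemma subspace_tangent_space: "subspace (tangent_space A p)"
  unfolding subspace_def tangent_space_def linear_on_def
  by (auto simp: scaleR_fun_def algebra_simps)

section \<open>Charts, smooth functions and their extension by zero\<close>

locale smooth_manifold =
  fixes A :: "('m::t2_space, 'e::euclidean_space) chart set"
  assumes atlas: "smooth_atlas A"
begin

lemma chart_homeomorphism: "(U, x) \<in> A \<Longrightarrow> homeomorphism U (x ` U) x (inv_into U x)"
  and open_chart_domain: "(U, x) \<in> A \<Longrightarrow> open U"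
  and open_chart_image: "(U, x) \<in> A \<Longrightarrow> open (x ` U)"
  using atlas by (auto simp: smooth_atlas_def is_chart_def)

lemma chart_inverse: "(U, x) \<in> A \<Longrightarrow> q \<in> U \<Longrightarrow> inv_into U x (x q) = q"
  using chart_homeomorphism by (auto simp: homeomorphism_def)

lemma chart_around: obtains U x where "(U, x) \<in> A" "p \<in> U"
proof -
  have "p \<in> (\<Union>(U, x)\<in>A. U)" using atlas by (simp add: smooth_atlas_def)
  then show ?thesis using that by auto
qed

lemma Ck_on_transition:
  "(U, x) \<in> A \<Longrightarrow> (V, y) \<in> A \<Longrightarrow> Ck_on k (x ` (U \<inter> V)) (y \<circ> inv_into U x)"
  using atlas by (fastforce simp: smooth_atlas_def smooth_on_def)

lemma open_chart_image_subset:
  assumes "(U, x) \<in> A" "open W" "W \<subseteq> U"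
  shows "open (x ` W)"
proof -
  have "x ` W = x ` U \<inter> inv_into U x -` W"
    using assms chart_inverse[OF assms(1)] by force
  moreover have "continuous_on (x ` U) (inv_into U x)"
    using chart_homeomorphism[OF assms(1)] by (simp add: homeomorphism_def)
  ultimately show ?thesis
    using continuous_open_preimage[OF _ open_chart_image[OF assms(1)] assms(2)] by simp
qed

lemma smooth_funs_const: "(\<lambda>q. c) \<in> smooth_funs A"
  by (rule smooth_funsI) (simp add: o_def Ck_on_const open_chart_image)

lemma smooth_funs_add: "f \<in> smooth_funs A \<Longrightarrow> h \<in> smooth_funs A \<Longrightarrow> (\<lambda>q. f q + h q) \<in> smooth_funs A"
  by (rule smooth_funsI) (auto simp: o_def intro!: Ck_on_add open_chart_image dest: smooth_funsD)

lemma smooth_funs_mult: "f \<in> smooth_funs A \<Longrightarrow> h \<in> smooth_funs A \<Longrightarrow> (\<lambda>q. f q * h q) \<in> smooth_funs A"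
  by (rule smooth_funsI) (auto simp: o_def intro!: Ck_on_mult open_chart_image dest: smooth_funsD)

lemma tangent_const:
  assumes "v \<in> tangent_space A p"
  shows "v (\<lambda>q. c) = 0"
proof -
  \<comment> \<open>The product rule for 1 = 1 * 1 reads v 1 = 2 * v 1.\<close>
  have "v (\<lambda>q. 1) = 0"
    using tangent_spaceD(2)[OF assms smooth_funs_const[of 1] smooth_funs_const[of 1]] by simp
  then show ?thesis
    using linear_onD(2)[OF tangent_spaceD(1)[OF assms] smooth_funs_const[of 1], of c]
    by (simp add: scaleR_fun_def)
qed

lemma subspace_vector_fields: "subspace (vector_fields A)"
  unfolding subspace_def vector_fields_def
  using subspace_0[OF subspace_tangent_space[of A]] subspace_add[OF subspace_tangent_space[of A]]
    subspace_scale[OF subspace_tangent_space[of A]]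
    smooth_funs_const[of 0] smooth_funs_add smooth_funs_mult[OF smooth_funs_const]
  by (auto simp: scaleR_fun_def zero_fun_def plus_fun_def)

lemma vector_fields_module:
  assumes "f \<in> smooth_funs A" "X \<in> vector_fields A"
  shows "(\<lambda>p. f p *\<^sub>R X p) \<in> vector_fields A"
proof -
  have "f p *\<^sub>R X p \<in> tangent_space A p" for p
    using subspace_scale[OF subspace_tangent_space] vector_fieldsD(1)[OF assms(2)] .
  moreover have "(\<lambda>p. (f p *\<^sub>R X p) h) \<in> smooth_funs A" if "h \<in> smooth_funs A" for h
    using smooth_funs_mult[OF assms(1) vector_fieldsD(2)[OF assms(2) that]]
    by (simp add: scaleR_fun_def)
  ultimately show ?thesis by (simp add: vector_fields_def)
qed

text \<open>Seen in a second chart on V, the function is F composed with a transition map over the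
  overlap, and zero away from the preimage of K in the manifold. That preimage is compact, hence
  closed by the Hausdorff property, so both pieces are open and \<open>Ck_on_Un\<close> glues
  them.\<close>

lemma smooth_funs_extend_by_zero:
  assumes c: "(U, x) \<in> A" and F: "\<And>k. Ck_on k (x ` U) F"
    and K: "compact K" "K \<subseteq> x ` U" "\<And>z. z \<in> x ` U \<Longrightarrow> z \<notin> K \<Longrightarrow> F z = 0"
  shows "(\<lambda>q. if q \<in> U then F (x q) else 0) \<in> smooth_funs A" (is "?F \<in> _")
proof (rule smooth_funsI)
  fix V y k assume d: "(V, y) \<in> A"
  let ?K = "inv_into U x ` K"
  have "continuous_on K (inv_into U x)"
    using chart_homeomorphism[OF c] K(2) continuous_on_subset by (auto simp: homeomorphism_def)
  then have closed: "closed ?K"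
    by (rule compact_imp_closed[OF compact_continuous_image[OF _ K(1)]])
  have "?K \<subseteq> U" using K(2) by (auto intro: inv_into_into)
  then have "V = (V \<inter> U) \<union> (V - ?K)" by blast
  then have cover: "y ` V = y ` (V \<inter> U) \<union> y ` (V - ?K)" by (metis image_Un)
  have op: "open (y ` (V \<inter> U))" "open (y ` (V - ?K))"
    using open_chart_domain[OF c] open_chart_domain[OF d] closed
    by (auto intro!: open_chart_image_subset[OF d])
  have "Ck_on k (y ` (V \<inter> U)) (\<lambda>z. F ((x \<circ> inv_into V y) z))"
    using chart_inverse[OF d]
    by (intro Ck_on_compose[OF op(1) open_chart_image[OF c] _ F Ck_on_transition[OF d c]]) auto
  then have "Ck_on k (y ` (V \<inter> U)) (?F \<circ> inv_into V y)"
    by (rule Ck_on_cong[OF op(1)]) (auto simp: chart_inverse[OF d])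
  moreover have "Ck_on k (y ` (V - ?K)) (?F \<circ> inv_into V y)"
  proof (rule Ck_on_cong[OF op(2) Ck_on_const[OF op(2)]])
    fix z assume "z \<in> y ` (V - ?K)"
    then obtain q where q: "q \<in> V" "q \<notin> ?K" "z = y q" by auto
    have "F (x q) = 0" if "q \<in> U"
    proof (rule K(3))
      show "x q \<notin> K" using q(2) chart_inverse[OF c that] by force
    qed (use that in auto)
    then show "0 = (?F \<circ> inv_into V y) z" using q chart_inverse[OF d] by simp
  qed
  ultimately show "Ck_on k (y ` V) (?F \<circ> inv_into V y)"
    unfolding cover by (rule Ck_on_Un[OF op])
qed

section \<open>Cut-off coordinate fields and extension of tangent vectors\<close>

lemma chart_derivative:
  assumes "(U, x) \<in> A" "f \<in> smooth_funs A" "z \<in> x ` U"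
  shows "(f \<circ> inv_into U x has_derivative frechet_derivative (f \<circ> inv_into U x) (at z)) (at z)"
  using Ck_on_SucD(1)[OF smooth_funsD[OF assms(2,1)] assms(3)] .

text \<open>The coordinate field in direction i, cut off by \<psi>. The inner default 0 makes it
  global once \<psi> has compact support in the chart; the outer one follows the convention of
  \<open>tangent_space\<close> for non-smooth functions.\<close>

definition coord_field :: "'m set \<Rightarrow> ('m \<Rightarrow> 'e) \<Rightarrow> ('e \<Rightarrow> real) \<Rightarrow> 'e \<Rightarrow> 'm vfield" where
  "coord_field U x \<psi> i = (\<lambda>q f. if f \<in> smooth_funs A
     then if q \<in> U then \<psi> (x q) * frechet_derivative (f \<circ> inv_into U x) (at (x q)) i else 0 else 0)"

lemma coord_field_in_vector_fields:
  assumes c: "(U, x) \<in> A" and \<psi>: "\<And>k. Ck_on k UNIV \<psi>"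
    and K: "compact K" "K \<subseteq> x ` U" "\<And>z. z \<notin> K \<Longrightarrow> \<psi> z = 0"
  shows "coord_field U x \<psi> i \<in> vector_fields A"
proof -
  let ?d = "\<lambda>q f. frechet_derivative (f \<circ> inv_into U x) (at (x q)) i"
  have tangent: "coord_field U x \<psi> i q \<in> tangent_space A q" for q
  proof (cases "q \<in> U")
    case True
    note der = chart_derivative[OF c _ imageI[OF True]]
    have add: "?d q (\<lambda>q. f q + h q) = ?d q f + ?d q h"
      if "f \<in> smooth_funs A" "h \<in> smooth_funs A" for f h
      using fun_cong[OF frechet_derivative_at[OF has_derivative_add[OF der[OF that(1)] der[OF that(2)]]], of i]
      by (simp add: o_def)
    have mult: "?d q (\<lambda>q. f q * h q) = f q * ?d q h + ?d q f * h q"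
      if "f \<in> smooth_funs A" "h \<in> smooth_funs A" for f h
      using fun_cong[OF frechet_derivative_at[OF has_derivative_mult[OF der[OF that(1)] der[OF that(2)]]], of i]
      by (simp add: o_def chart_inverse[OF c True])
    have scale: "?d q (\<lambda>q. a * f q) = a * ?d q f" if "f \<in> smooth_funs A" for a f
    proof -
      \<comment> \<open>Homogeneity is the product rule with a constant factor.\<close>
      have "?d q (\<lambda>q. a) = 0" by (simp add: o_def)
      then show ?thesis using mult[OF smooth_funs_const that, of a] by simp
    qed
    show ?thesis
      using True add mult scale smooth_funs_add smooth_funs_mult smooth_funs_const
      by (auto simp: tangent_space_def linear_on_def coord_field_def plus_fun_def scaleR_fun_def algebra_simps)
  next
    case False
    then show ?thesis using subspace_0[OF subspace_tangent_space[of A q]]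
      by (simp add: coord_field_def zero_fun_def cong: if_cong)
  qed
  have "(\<lambda>q. coord_field U x \<psi> i q f) \<in> smooth_funs A" if f: "f \<in> smooth_funs A" for f
  proof -
    have "(\<lambda>q. if q \<in> U then (\<lambda>z. \<psi> z * frechet_derivative (f \<circ> inv_into U x) (at z) i) (x q) else 0) \<in> smooth_funs A"
    proof (rule smooth_funs_extend_by_zero[OF c _ K(1,2)])
      show "Ck_on k (x ` U) (\<lambda>z. \<psi> z * frechet_derivative (f \<circ> inv_into U x) (at z) i)" for k
        using Ck_on_SucD(2)[OF smooth_funsD[OF f c]] Ck_on_subset[OF \<psi>] open_chart_image[OF c]
        by (intro Ck_on_mult) auto
    qed (simp add: K(3))
    then show ?thesis using f by (simp add: coord_field_def)
  qed
  then show ?thesis using tangent by (simp add: vector_fields_def)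
qed

text \<open>The fields are cut-off coordinate fields of a chart around p. Cut-off coordinate
  functions \<open>h j\<close> form a dual family up to the factor \<psi>(a)^2 > 0, so applying a
  vanishing linear combination to \<open>h j\<close> isolates its j-th coefficient.\<close>

lemma independent_vector_fields_exist:
  "\<exists>X :: 'e \<Rightarrow> 'm vfield. (\<forall>i. X i \<in> vector_fields A) \<and> inj_on (\<lambda>i. X i p) Basis
     \<and> independent ((\<lambda>i. X i p) ` Basis)"
proof -
  obtain U x where c: "(U, x) \<in> A" and p: "p \<in> U" by (rule chart_around)
  define a where "a = x p"
  obtain r where r: "r > 0" "cball a r \<subseteq> x ` U"
    using open_chart_image[OF c] p a_def open_contains_cball by (metis imageI)
  define \<psi> where "\<psi> = (\<lambda>z. bump_fun 0 (r\<^sup>2 - (z - a) \<bullet> (z - a)))"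
  have \<psi>: "Ck_on k UNIV \<psi>" for k unfolding \<psi>_def by (rule Ck_on_ball_bump)
  have supp: "\<psi> z = 0" if "z \<notin> cball a r" for z
  proof -
    have "r < norm (z - a)" using that by (simp add: dist_norm norm_minus_commute)
    then have "r\<^sup>2 < (norm (z - a))\<^sup>2" using r by (intro power_strict_mono) auto
    then show ?thesis by (simp add: \<psi>_def bump_fun_def power2_norm_eq_inner)
  qed
  have pos: "\<psi> a > 0" using r by (simp add: \<psi>_def bump_fun_def)
  \<comment> \<open>Centring the coordinates at a makes the term with the derivative of \<psi>
    vanish at a; one factor \<psi>(a) comes from \<open>h j\<close>, the other from the
    field.\<close>
  define h where "h j q = (if q \<in> U then (\<lambda>z. \<psi> z * ((z - a) \<bullet> j)) (x q) else 0)" for j q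
  have lin: "Ck_on k UNIV (\<lambda>z. (z - a) \<bullet> j)" for k j
    using Ck_on_add[OF open_UNIV Ck_on_bounded_linear[OF open_UNIV bounded_linear_inner_left[of j]]
        Ck_on_const[OF open_UNIV, of k "- (a \<bullet> j)"]]
    by (simp add: inner_diff_left)
  have h: "h j \<in> smooth_funs A" for j
    unfolding h_def
  proof (rule smooth_funs_extend_by_zero[OF c _ compact_cball r(2)])
    show "Ck_on k (x ` U) (\<lambda>z. \<psi> z * ((z - a) \<bullet> j))" for k
      using Ck_on_subset[OF Ck_on_mult[OF open_UNIV \<psi> lin]] by simp
  qed (simp add: supp)
  define X where "X = coord_field U x \<psi>"
  have X: "X i \<in> vector_fields A" for i
    unfolding X_def by (rule coord_field_in_vector_fields[OF c \<psi> compact_cball r(2) supp])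
  have dual: "X i p (h j) = (\<psi> a)\<^sup>2 * (i \<bullet> j)" for i j
  proof -
    have "(\<psi> has_derivative frechet_derivative \<psi> (at a)) (at a)"
      using Ck_on_SucD(1)[OF \<psi>] by simp
    moreover have "((\<lambda>z. (z - a) \<bullet> j) has_derivative (\<lambda>v. v \<bullet> j)) (at a)"
      by (auto intro!: derivative_eq_intros)
    ultimately have "((\<lambda>z. \<psi> z * ((z - a) \<bullet> j)) has_derivative
        (\<lambda>v. \<psi> a * (v \<bullet> j) + frechet_derivative \<psi> (at a) v * ((a - a) \<bullet> j))) (at a)"
      by (rule has_derivative_mult)
    then have "(h j \<circ> inv_into U x has_derivative
        (\<lambda>v. \<psi> a * (v \<bullet> j) + frechet_derivative \<psi> (at a) v * ((a - a) \<bullet> j))) (at a)"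
    proof (rule has_derivative_transform_within_open[OF _ open_chart_image[OF c]])
      show "a \<in> x ` U" using p by (simp add: a_def)
    qed (auto simp: h_def chart_inverse[OF c])
    from frechet_derivative_at[OF this, symmetric] show ?thesis
      using h[of j] p by (simp add: X_def coord_field_def a_def[symmetric] power2_eq_square)
  qed
  have inj: "inj_on (\<lambda>i. X i p) Basis"
  proof (rule inj_onI)
    fix i j :: 'e assume ij: "i \<in> Basis" "j \<in> Basis" "X i p = X j p"
    then have "(\<psi> a)\<^sup>2 * (i \<bullet> j) = (\<psi> a)\<^sup>2 * (j \<bullet> j)"
      using dual[of i j] dual[of j j] by simp
    then show "i = j" using pos ij by (auto simp: inner_Basis split: if_splits)
  qed
  have sum_apply: "(\<Sum>i\<in>I. v i) f = (\<Sum>i\<in>I. v i f)" for v :: "'e \<Rightarrow> 'm tangent" and I f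
    by (induction I rule: infinite_finite_induct) auto
  have "independent ((\<lambda>i. X i p) ` Basis)"
  proof
    assume "dependent ((\<lambda>i. X i p) ` Basis)"
    then obtain u j where j: "j \<in> Basis" "u (X j p) \<noteq> 0"
      and "(\<Sum>w\<in>(\<lambda>i. X i p) ` Basis. u w *\<^sub>R w) = 0"
      by (subst (asm) dependent_finite) auto
    then have "(\<Sum>i\<in>Basis. u (X i p) *\<^sub>R X i p) = 0"
      by (simp add: sum.reindex[OF inj])
    then have "(\<Sum>i\<in>Basis. u (X i p) *\<^sub>R X i p) (h j) = 0" by simp
    then have "(\<Sum>i\<in>Basis. u (X i p) * ((\<psi> a)\<^sup>2 * (i \<bullet> j))) = 0"
      by (simp add: sum_apply scaleR_fun_def dual)
    moreover have "u (X i p) * ((\<psi> a)\<^sup>2 * (i \<bullet> j)) = (if i = j then u (X j p) * (\<psi> a)\<^sup>2 else 0)"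
      if "i \<in> Basis" for i
      using that j by (simp add: inner_Basis)
    ultimately have "u (X j p) * (\<psi> a)\<^sup>2 = 0"
      using j by (simp cong: sum.cong)
    then show False using j pos by simp
  qed
  then show ?thesis using X inj by (intro exI[of _ X]) simp
qed

text \<open>The upper bound on the dimension of the tangent space holds on every smooth manifold; taking
  it as a hypothesis, which a metric of the right signature provides, spares Hadamard's lemma.\<close>

lemma vector_field_extension:
  assumes B: "finite B" "card B \<le> DIM('e)" "tangent_space A p = span B"
    and v: "v \<in> tangent_space A p"
  obtains X where "X \<in> vector_fields A" "X p = v"
proof -
  obtain X :: "'e \<Rightarrow> 'm vfield" where X: "\<And>i. X i \<in> vector_fields A" "inj_on (\<lambda>i. X i p) Basis"
      "independent ((\<lambda>i. X i p) ` Basis)"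
    using independent_vector_fields_exist[of p] by auto
  let ?E = "(\<lambda>i. X i p) ` Basis"
  have card: "card ?E = DIM('e)" using X(2) by (rule card_image)
  \<comment> \<open>Otherwise v together with \<open>?E\<close> would be DIM('e) + 1 independent
    vectors in the span of at most DIM('e) vectors.\<close>
  have "v \<in> span ?E"
  proof (rule ccontr)
    assume nv: "v \<notin> span ?E"
    have "v \<notin> ?E" using span_superset nv by (rule contra_subsetD)
    have "independent (insert v ?E)" using nv X(3) by (rule independent_insertI)
    moreover have "insert v ?E \<subseteq> span B"
      using v vector_fieldsD(1)[OF X(1)] B(3) by auto
    ultimately have "card (insert v ?E) \<le> card B"
      using independent_span_bound[OF B(1)] by blast
    then show False using card B(2) \<open>v \<notin> ?E\<close> by simp
  qed
  \<comment> \<open>Evaluation at p is linear, so the values at p of vector fields form a subspace,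
    which contains the span as soon as it contains \<open>?E\<close>.\<close>
  moreover have "span ?E \<subseteq> (\<lambda>Y. Y p) ` vector_fields A"
  proof (rule span_minimal)
    show "?E \<subseteq> (\<lambda>Y. Y p) ` vector_fields A" using X(1) by auto
    have "linear (\<lambda>Y :: 'm vfield. Y p)" by (rule linearI) (simp_all add: scaleR_fun_def)
    then show "subspace ((\<lambda>Y. Y p) ` vector_fields A)"
      using subspace_vector_fields by (rule linear_subspace_image)
  qed
  ultimately show ?thesis using that by (metis (no_types, lifting) imageE subsetD)
qed

end

section \<open>Para-Kenmotsu geometry\<close>

lemma basis_cards_eq:
  assumes "finite B" "independent B" "independent C" "span B = span C"
  shows "finite C" "card B = card C"
proof -
  show "finite C"
    using independent_span_bound[OF assms(1,3)] span_superset[of C] assms(4) by auto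
  then show "card B = card C"
    using independent_span_bound[OF assms(1,3)] independent_span_bound[OF _ assms(2), of C]
      span_superset[of B] span_superset[of C] assms(4) by (auto intro: antisym)
qed

text \<open>The trace of x \<mapsto> \<alpha>(x) w is \<alpha>(w), and the identity contributes the
  dimension. The map x \<mapsto> R(x, Y)\<xi> has this shape, with w = Y and c = \<eta>(Y).\<close>

lemma trace_on_rank_one_minus_scalar:
  assumes B: "finite B" "independent B" "span B = V"
    and \<alpha>: "linear_on V \<alpha>" and w: "w \<in> V"
    and f: "\<And>x. x \<in> V \<Longrightarrow> f x = \<alpha> x *\<^sub>R w - c *\<^sub>R x"
  shows "trace_on V f = \<alpha> w - c * real (card B)"
proof -
  define C where "C = (SOME B. B \<subseteq> V \<and> independent B \<and> span B = V)"
  have "\<exists>B. B \<subseteq> V \<and> independent B \<and> span B = V"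
    using B span_superset[of B] by auto
  from someI_ex[OF this] have C: "C \<subseteq> V" "independent C" "span C = V"
    by (auto simp: C_def)
  have card: "finite C" "card B = card C"
    using basis_cards_eq[OF B(1,2) C(2)] B C by auto
  have V: "subspace V" using C(3) subspace_span by metis
  have "trace_on V f = (\<Sum>b\<in>C. representation C (f b) b)"
    by (simp add: trace_on_def C_def Let_def)
  also have "\<dots> = (\<Sum>b\<in>C. representation C w b * \<alpha> b - c)"
  proof (rule sum.cong[OF refl])
    fix b assume b: "b \<in> C"
    have "f b = \<alpha> b *\<^sub>R w - c *\<^sub>R b" using f b C(1) by auto
    moreover have "b \<in> span C" "w \<in> span C" using b w C span_base by auto
    ultimately show "representation C (f b) b = representation C w b * \<alpha> b - c"
      using representation_diff[OF C(2) span_scale span_scale, of b w "\<alpha> b" c]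
      by (simp add: representation_scale[OF C(2)] representation_basis[OF C(2) b])
  qed
  also have "\<dots> = (\<Sum>b\<in>C. \<alpha> (representation C w b *\<^sub>R b)) - c * real (card C)"
    using C(1) by (simp add: sum_subtractf linear_onD(2)[OF \<alpha>] subset_iff)
  also have "(\<Sum>b\<in>C. \<alpha> (representation C w b *\<^sub>R b)) = \<alpha> (\<Sum>b\<in>C. representation C w b *\<^sub>R b)"
    using C(1) by (intro linear_on_sum[OF \<alpha> V, symmetric]) (auto intro: subspace_scale[OF V])
  also have "(\<Sum>b\<in>C. representation C w b *\<^sub>R b) = w"
    using w C card by (intro sum_representation_eq) auto
  finally show ?thesis using card by simp
qed

section \<open>Basic properties of the structure tensors and the connection\<close>

locale para_kenmotsu_manifold = smooth_manifold A
  for A :: "('m::t2_space, 'e::euclidean_space) chart set" +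
  fixes n :: nat and \<phi> :: "'m \<Rightarrow> 'm tangent \<Rightarrow> 'm tangent" and \<xi> :: "'m vfield"
    and \<eta> :: "'m \<Rightarrow> 'm tangent \<Rightarrow> real" and g :: "'m \<Rightarrow> 'm tangent \<Rightarrow> 'm tangent \<Rightarrow> real"
    and D :: "'m vfield \<Rightarrow> 'm vfield \<Rightarrow> 'm vfield"
  assumes dimension: "DIM('e) = 2 * n + 1"
    and para_kenmotsu: "para_kenmotsu A n \<phi> \<xi> \<eta> g D"
begin

lemma paracontact: "almost_paracontact_metric A n \<phi> \<xi> \<eta> g"
  and levi_civita: "levi_civita A g D"
  and D_phi: "X \<in> vector_fields A \<Longrightarrow> Y \<in> vector_fields A \<Longrightarrow>
    D X (\<lambda>q. \<phi> q (Y q)) p - \<phi> p (D X Y p) = g p (\<phi> p (X p)) (Y p) *\<^sub>R \<xi> p - \<eta> p (Y p) *\<^sub>R \<phi> p (X p)"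
  using para_kenmotsu by (auto simp: para_kenmotsu_def)

lemma endo_field_phi: "endo_field A \<phi>"
  and xi_field: "\<xi> \<in> vector_fields A"
  and one_form_eta: "one_form A \<eta>"
  and metric: "pseudo_riemannian_metric A (n + 1) n g"
  and phi_xi: "\<phi> p (\<xi> p) = 0"
  and eta_phi: "v \<in> tangent_space A p \<Longrightarrow> \<eta> p (\<phi> p v) = 0"
  and eta_xi: "\<eta> p (\<xi> p) = 1"
  and phi_phi: "v \<in> tangent_space A p \<Longrightarrow> \<phi> p (\<phi> p v) = v - \<eta> p v *\<^sub>R \<xi> p"
  and metric_phi: "X \<in> vector_fields A \<Longrightarrow> Y \<in> vector_fields A \<Longrightarrow>
    g p (\<phi> p (X p)) (\<phi> p (Y p)) = - g p (X p) (Y p) + \<eta> p (X p) * \<eta> p (Y p)"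
  using paracontact by (auto simp: almost_paracontact_metric_def)

lemma phi_field: "X \<in> vector_fields A \<Longrightarrow> (\<lambda>p. \<phi> p (X p)) \<in> vector_fields A"
  using endo_field_phi by (auto simp: endo_field_def)

lemma eta_linear: "linear_on (tangent_space A p) (\<eta> p)"
  and eta_smooth: "X \<in> vector_fields A \<Longrightarrow> (\<lambda>p. \<eta> p (X p)) \<in> smooth_funs A"
  using one_form_eta by (auto simp: one_form_def)

lemma metric_sym: "v \<in> tangent_space A p \<Longrightarrow> w \<in> tangent_space A p \<Longrightarrow> g p v w = g p w v"
  and metric_linear: "v \<in> tangent_space A p \<Longrightarrow> linear_on (tangent_space A p) (g p v)"
  and metric_signature: "has_signature (tangent_space A p) (g p) (n + 1) n"
  and metric_smooth: "X \<in> vector_fields A \<Longrightarrow> Y \<in> vector_fields A \<Longrightarrow>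
    (\<lambda>p. g p (X p) (Y p)) \<in> smooth_funs A"
  using metric by (auto simp: pseudo_riemannian_metric_def sym_bilinear_on_def)

lemma metric_diff_right:
  assumes "u \<in> tangent_space A p" "v \<in> tangent_space A p" "w \<in> tangent_space A p"
  shows "g p u (v - w) = g p u v - g p u w"
  using linear_on_diff[OF metric_linear subspace_tangent_space] assms by blast

lemma metric_diff_left:
  assumes "u \<in> tangent_space A p" "v \<in> tangent_space A p" "w \<in> tangent_space A p"
  shows "g p (v - w) u = g p v u - g p w u"
  using metric_diff_right[OF assms] metric_sym assms subspace_diff[OF subspace_tangent_space]
  by metis

lemma connection: "affine_connection A D"
  and D_torsion: "X \<in> vector_fields A \<Longrightarrow> Y \<in> vector_fields A \<Longrightarrow> lie_bracket A X Y = D X Y - D Y X"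
  and D_metric: "X \<in> vector_fields A \<Longrightarrow> Y \<in> vector_fields A \<Longrightarrow> Z \<in> vector_fields A \<Longrightarrow>
    X p (\<lambda>q. g q (Y q) (Z q)) = g p (D X Y p) (Z p) + g p (Y p) (D X Z p)"
  using levi_civita by (auto simp: levi_civita_def)

lemma D_field: "X \<in> vector_fields A \<Longrightarrow> Y \<in> vector_fields A \<Longrightarrow> D X Y \<in> vector_fields A"
  and D_linear: "X \<in> vector_fields A \<Longrightarrow> linear_on (vector_fields A) (D X)"
  and D_leibniz: "f \<in> smooth_funs A \<Longrightarrow> X \<in> vector_fields A \<Longrightarrow> Y \<in> vector_fields A \<Longrightarrow>
    D X (\<lambda>p. f p *\<^sub>R Y p) = (\<lambda>p. X p f *\<^sub>R Y p + f p *\<^sub>R D X Y p)"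
  using connection by (auto simp: affine_connection_def)

lemma bracket_field:
  "X \<in> vector_fields A \<Longrightarrow> Y \<in> vector_fields A \<Longrightarrow> lie_bracket A X Y \<in> vector_fields A"
  by (simp add: D_torsion D_field subspace_diff[OF subspace_vector_fields])

lemma curvature_field:
  "X \<in> vector_fields A \<Longrightarrow> Y \<in> vector_fields A \<Longrightarrow> Z \<in> vector_fields A \<Longrightarrow>
    curvature A D X Y Z \<in> vector_fields A"
  unfolding curvature_def
  by (intro subspace_diff[OF subspace_vector_fields] D_field bracket_field)

text \<open>The orthonormal basis of the signature serves three ends: it bounds the dimension for
  \<open>vector_field_extension\<close>, gives the dimension in the Ricci trace, and supplies
  vectors of square -1.\<close>

lemma tangent_basis:
  obtains B N where "finite B" "independent B" "span B = tangent_space A p" "card B = 2 * n + 1"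
    "N \<subseteq> B" "card N = n" "\<forall>w\<in>N. g p w w = -1"
proof -
  obtain P N where PN: "finite P" "finite N" "P \<inter> N = {}" "card P = n + 1" "card N = n"
      "independent (P \<union> N)" "span (P \<union> N) = tangent_space A p" "\<forall>v\<in>N. g p v v = -1"
    using metric_signature[of p] unfolding has_signature_def by (elim exE conjE)
  show ?thesis
  proof (rule that[OF _ PN(6,7) _ _ PN(5,8)])
    show "card (P \<union> N) = 2 * n + 1" using PN(1-5) by (simp add: card_Un_disjoint)
  qed (use PN(1,2) in simp_all)
qed

lemma tangent_extension:
  assumes "v \<in> tangent_space A p"
  obtains X where "X \<in> vector_fields A" "X p = v"
proof (rule tangent_basis[of p])
  fix B :: "'m tangent set"
  assume "finite B" "span B = tangent_space A p" "card B = 2 * n + 1"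
  with dimension have "finite B" "card B \<le> DIM('e)" "tangent_space A p = span B" by auto
  from this assms that show thesis by (rule vector_field_extension)
qed

section \<open>Covariant derivative and curvature in the direction of \<xi>\<close>

lemma metric_xi:
  assumes "X \<in> vector_fields A"
  shows "g p (X p) (\<xi> p) = \<eta> p (X p)"
  \<comment> \<open>For Y = \<xi> the left side of the compatibility condition vanishes, because
    \<phi> \<xi> = 0.\<close>
  using metric_phi[OF assms xi_field, of p] phi_xi[of p] eta_xi[of p]
    linear_on_zero[OF metric_linear[OF vector_fieldsD(1)[OF phi_field[OF assms]]] subspace_tangent_space, of p]
  by simp

text \<open>The para-Kenmotsu identity for Y = \<xi> gives \<phi>(\<nabla>_X \<xi>) = \<phi> X. A
  second application of \<phi> determines \<nabla>_X \<xi> up to its \<xi>-component.\<close>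

lemma D_xi:
  assumes X: "X \<in> vector_fields A"
  shows "D X \<xi> p = X p - \<eta> p (X p) *\<^sub>R \<xi> p"
proof -
  note T = vector_fieldsD(1)[OF X, of p] vector_fieldsD(1)[OF D_field[OF X xi_field], of p]
  have "D X (\<lambda>q. \<phi> q (\<xi> q)) = 0"
    using linear_on_zero[OF D_linear[OF X] subspace_vector_fields] by (simp add: phi_xi flip: zero_fun_def)
  moreover have "g p (\<phi> p (X p)) (\<xi> p) = 0"
    using metric_xi[OF phi_field[OF X]] eta_phi[OF T(1)] by simp
  ultimately have "\<phi> p (D X \<xi> p) = \<phi> p (X p)"
    using D_phi[OF X xi_field, of p] eta_xi[of p] by simp
  then have *: "D X \<xi> p - \<eta> p (D X \<xi> p) *\<^sub>R \<xi> p = X p - \<eta> p (X p) *\<^sub>R \<xi> p"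
    using phi_phi[OF T(1)] phi_phi[OF T(2)] by simp
  \<comment> \<open>The \<xi>-component is zero because g(\<xi>, \<xi>) is the constant 1.\<close>
  have "X p (\<lambda>q. g q (\<xi> q) (\<xi> q)) = 2 * \<eta> p (D X \<xi> p)"
    using D_metric[OF X xi_field xi_field, of p] metric_xi[OF D_field[OF X xi_field], of p]
      metric_sym[OF vector_fieldsD(1)[OF xi_field] T(2)]
    by simp
  then have "\<eta> p (D X \<xi> p) = 0"
    using tangent_const[OF T(1), of 1] by (simp add: metric_xi[OF xi_field] eta_xi)
  then show ?thesis using * by simp
qed

text \<open>Differentiate \<eta>(Y) = g(Y, \<xi>) and insert \<open>D_xi\<close>. The correction g -
  \<eta> \<otimes> \<eta> is symmetric in X and Y, whence d\<eta> = 0 in the next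
  computation.\<close>

lemma derivative_eta:
  assumes X: "X \<in> vector_fields A" and Y: "Y \<in> vector_fields A"
  shows "X p (\<lambda>q. \<eta> q (Y q)) = \<eta> p (D X Y p) + g p (X p) (Y p) - \<eta> p (X p) * \<eta> p (Y p)"
proof -
  note T = vector_fieldsD(1)[OF X, of p] vector_fieldsD(1)[OF Y, of p] vector_fieldsD(1)[OF xi_field, of p]
  have "X p (\<lambda>q. \<eta> q (Y q)) = g p (D X Y p) (\<xi> p) + g p (Y p) (D X \<xi> p)"
    using D_metric[OF X Y xi_field] by (simp add: metric_xi[OF Y])
  also have "g p (D X Y p) (\<xi> p) = \<eta> p (D X Y p)"
    by (rule metric_xi[OF D_field[OF X Y]])
  also have "g p (Y p) (D X \<xi> p) = g p (Y p) (X p) - \<eta> p (X p) * g p (Y p) (\<xi> p)"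
    using T linear_onD(2)[OF metric_linear[OF T(2)] T(3)]
    by (simp add: D_xi[OF X] metric_diff_right subspace_scale[OF subspace_tangent_space])
  also have "g p (Y p) (X p) = g p (X p) (Y p)" by (rule metric_sym[OF T(2,1)])
  finally show ?thesis by (simp add: metric_xi[OF Y])
qed

lemma D_D_xi:
  assumes X: "X \<in> vector_fields A" and Y: "Y \<in> vector_fields A"
  shows "D X (D Y \<xi>) p = D X Y p - X p (\<lambda>q. \<eta> q (Y q)) *\<^sub>R \<xi> p
    - \<eta> p (Y p) *\<^sub>R (X p - \<eta> p (X p) *\<^sub>R \<xi> p)"
proof -
  let ?f = "\<lambda>q. \<eta> q (Y q)"
  have "D Y \<xi> = Y - (\<lambda>q. ?f q *\<^sub>R \<xi> q)" by (simp add: fun_eq_iff D_xi[OF Y])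
  then have "D X (D Y \<xi>) = D X Y - D X (\<lambda>q. ?f q *\<^sub>R \<xi> q)"
    using linear_on_diff[OF D_linear[OF X] subspace_vector_fields Y vector_fields_module[OF eta_smooth[OF Y] xi_field]]
    by simp
  then show ?thesis
    using D_leibniz[OF eta_smooth[OF Y] X xi_field] by (simp add: D_xi[OF X])
qed

text \<open>By torsion-freeness the terms \<nabla>_X Y and \<nabla>_Y X cancel against the bracket.
  The remaining coefficient of \<xi> is -d\<eta>(X, Y), which is zero.\<close>

lemma curvature_xi:
  assumes X: "X \<in> vector_fields A" and Y: "Y \<in> vector_fields A"
  shows "curvature A D X Y \<xi> p = \<eta> p (X p) *\<^sub>R Y p - \<eta> p (Y p) *\<^sub>R X p"
proof -
  note T = vector_fieldsD(1)[OF X, of p] vector_fieldsD(1)[OF Y, of p]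
    vector_fieldsD(1)[OF D_field[OF X Y], of p] vector_fieldsD(1)[OF D_field[OF Y X], of p]
  have "\<eta> p (lie_bracket A X Y p) = \<eta> p (D X Y p) - \<eta> p (D Y X p)"
    using linear_on_diff[OF eta_linear subspace_tangent_space T(3,4)] by (simp add: D_torsion[OF X Y])
  then have d_eta: "X p (\<lambda>q. \<eta> q (Y q)) - Y p (\<lambda>q. \<eta> q (X q)) = \<eta> p (lie_bracket A X Y p)"
    using derivative_eta[OF X Y, of p] derivative_eta[OF Y X, of p] metric_sym[OF T(1,2)] by simp
  have "lie_bracket A X Y p = D X Y p - D Y X p" by (simp add: D_torsion[OF X Y])
  then have "curvature A D X Y \<xi> p = \<eta> p (X p) *\<^sub>R Y p - \<eta> p (Y p) *\<^sub>R X p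
      - (X p (\<lambda>q. \<eta> q (Y q)) - Y p (\<lambda>q. \<eta> q (X q)) - \<eta> p (lie_bracket A X Y p)) *\<^sub>R \<xi> p"
    by (simp add: curvature_def D_D_xi[OF X Y] D_D_xi[OF Y X] D_xi[OF bracket_field[OF X Y]]
        algebra_simps)
  then show ?thesis by (simp add: d_eta)
qed

text \<open>Apply [X, Y] to g(Z, W), once as a commutator of second derivatives and once through
  metric compatibility. The mixed terms with one derivative on each of Z and W are symmetric in X
  and Y and cancel.\<close>

lemma curvature_skew:
  assumes X: "X \<in> vector_fields A" and Y: "Y \<in> vector_fields A"
    and Z: "Z \<in> vector_fields A" and W: "W \<in> vector_fields A"
  shows "g p (curvature A D X Y Z p) (W p) = - g p (Z p) (curvature A D X Y W p)"
proof -
  let ?h = "\<lambda>q. g q (Z q) (W q)"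
  \<comment> \<open>X and Y are rebound, as the expansion is used in both orders.\<close>
  have second: "X p (\<lambda>q. Y q ?h) = g p (D X (D Y Z) p) (W p) + g p (D Y Z p) (D X W p)
      + g p (D X Z p) (D Y W p) + g p (Z p) (D X (D Y W) p)"
    if X: "X \<in> vector_fields A" and Y: "Y \<in> vector_fields A" for X Y
  proof -
    have "X p (\<lambda>q. Y q ?h) = X p ((\<lambda>q. g q (D Y Z q) (W q)) + (\<lambda>q. g q (Z q) (D Y W q)))"
      by (simp add: D_metric[OF Y Z W] plus_fun_def)
    also have "\<dots> = X p (\<lambda>q. g q (D Y Z q) (W q)) + X p (\<lambda>q. g q (Z q) (D Y W q))"
      by (intro linear_onD(1)[OF tangent_spaceD(1)[OF vector_fieldsD(1)[OF X]]] metric_smooth D_field Y Z W)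
    also have "\<dots> = g p (D X (D Y Z) p) (W p) + g p (D Y Z p) (D X W p)
      + g p (D X Z p) (D Y W p) + g p (Z p) (D X (D Y W) p)"
      using X Y Z W by (simp add: D_metric D_field)
    finally show ?thesis .
  qed
  have "lie_bracket A X Y p ?h = X p (\<lambda>q. Y q ?h) - Y p (\<lambda>q. X q ?h)"
    using metric_smooth[OF Z W] by (simp add: lie_bracket_def)
  moreover have "lie_bracket A X Y p ?h
      = g p (D (lie_bracket A X Y) Z p) (W p) + g p (Z p) (D (lie_bracket A X Y) W p)"
    using bracket_field[OF X Y] Z W by (rule D_metric)
  moreover have T: "Z p \<in> tangent_space A p" "W p \<in> tangent_space A p"
    "D X (D Y Z) p \<in> tangent_space A p" "D Y (D X Z) p \<in> tangent_space A p"
    "D X (D Y W) p \<in> tangent_space A p" "D Y (D X W) p \<in> tangent_space A p"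
    "D (lie_bracket A X Y) Z p \<in> tangent_space A p" "D (lie_bracket A X Y) W p \<in> tangent_space A p"
    by (intro vector_fieldsD(1) D_field bracket_field X Y Z W)+
  moreover note second[OF X Y] second[OF Y X]
  ultimately show ?thesis
    by (simp add: curvature_def metric_diff_left metric_diff_right subspace_diff[OF subspace_tangent_space])
qed

text \<open>Skew-symmetry trades the unknown R(\<xi>, X)Y for R(\<xi>, X)\<xi>, which
  \<open>curvature_xi\<close> computes.\<close>

lemma eta_curvature_xi:
  assumes X: "X \<in> vector_fields A" and Y: "Y \<in> vector_fields A"
  shows "\<eta> p (curvature A D \<xi> X Y p) = - g p (Y p) (curvature A D \<xi> X \<xi> p)"
  using curvature_skew[OF xi_field X Y xi_field, of p] metric_xi[OF curvature_field[OF xi_field X Y], of p]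
  by simp

lemma ricci_xi:
  assumes Y: "Y \<in> vector_fields A"
  shows "ricci A D Y \<xi> p = - 2 * real n * \<eta> p (Y p)"
proof (rule tangent_basis[of p])
  fix B :: "'m tangent set"
  assume B: "finite B" "independent B" "span B = tangent_space A p" "card B = 2 * n + 1"
  \<comment> \<open>Since \<open>curvature_xi\<close> involves only the value of X at p, the choice
    of the extension does not affect the result.\<close>
  have "curvature A D (SOME X. X \<in> vector_fields A \<and> X p = x) Y \<xi> p
      = \<eta> p x *\<^sub>R Y p - \<eta> p (Y p) *\<^sub>R x" if x: "x \<in> tangent_space A p" for x
  proof -
    have "\<exists>X. X \<in> vector_fields A \<and> X p = x" using tangent_extension[OF x] by blast
    from someI_ex[OF this] show ?thesis by (simp add: curvature_xi Y)
  qed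
  from trace_on_rank_one_minus_scalar[OF B(1-3) eta_linear vector_fieldsD(1)[OF Y] this]
  show ?thesis by (simp add: ricci_def B(4) algebra_simps)
qed

text \<open>Metric compatibility and vanishing torsion reduce the Lie derivative to g(\<nabla>_X
  \<xi>, Y) + g(X, \<nabla>_Y \<xi>), to which \<open>D_xi\<close> applies.\<close>

lemma lie_derivative_metric_xi:
  assumes X: "X \<in> vector_fields A" and Y: "Y \<in> vector_fields A"
  shows "lie_derivative_metric A \<xi> g X Y p = 2 * (g p (X p) (Y p) - \<eta> p (X p) * \<eta> p (Y p))"
proof -
  note XI = xi_field
  have T: "X p \<in> tangent_space A p" "Y p \<in> tangent_space A p" "\<xi> p \<in> tangent_space A p"
    "D \<xi> X p \<in> tangent_space A p" "D \<xi> Y p \<in> tangent_space A p"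
    "D X \<xi> p \<in> tangent_space A p" "D Y \<xi> p \<in> tangent_space A p"
    by (intro vector_fieldsD(1) D_field X Y XI)+
  have half: "g p (U p) (D V \<xi> p) = g p (U p) (V p) - \<eta> p (V p) * \<eta> p (U p)"
    if U: "U \<in> vector_fields A" and V: "V \<in> vector_fields A" for U V
    using vector_fieldsD(1)[OF U, of p] vector_fieldsD(1)[OF V, of p] T(3)
      linear_onD(2)[OF metric_linear[OF vector_fieldsD(1)[OF U]] T(3)]
    by (simp add: D_xi[OF V] metric_diff_right subspace_scale[OF subspace_tangent_space] metric_xi[OF U])
  have "lie_derivative_metric A \<xi> g X Y p = g p (D X \<xi> p) (Y p) + g p (X p) (D Y \<xi> p)"
    using T by (simp add: lie_derivative_metric_def D_metric[OF XI X Y] D_torsion[OF XI X]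
        D_torsion[OF XI Y] metric_diff_left metric_diff_right)
  also have "g p (D X \<xi> p) (Y p) = g p (Y p) (D X \<xi> p)" by (rule metric_sym[OF T(6,2)])
  finally show ?thesis
    using half[OF X Y] half[OF Y X] metric_sym[OF T(1,2)] by simp
qed

section \<open>The Ricci tensor and the constants of the soliton\<close>

lemma ricci_eta_soliton:
  assumes "eta_ricci_soliton A \<eta> D g \<xi> l m" "X \<in> vector_fields A" "Y \<in> vector_fields A"
  shows "ricci A D X Y p = - (1 + l) * g p (X p) (Y p) + (1 - m) * (\<eta> p (X p) * \<eta> p (Y p))"
proof -
  have "lie_derivative_metric A \<xi> g X Y p + 2 * ricci A D X Y p + 2 * l * g p (X p) (Y p)
      + 2 * m * (\<eta> p (X p) * \<eta> p (Y p)) = 0"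
    using assms unfolding eta_ricci_soliton_def by blast
  then show ?thesis
    by (simp add: lie_derivative_metric_xi[OF assms(2,3)] algebra_simps)
qed

lemma eta_soliton_constants:
  assumes n: "n \<ge> 1" and sol: "eta_ricci_soliton A \<eta> D g \<xi> l m"
    and R: "\<And>X Y Z p. X \<in> vector_fields A \<Longrightarrow> Y \<in> vector_fields A \<Longrightarrow> Z \<in> vector_fields A \<Longrightarrow>
      ricci A D (curvature A D \<xi> X Y) Z p + ricci A D Y (curvature A D \<xi> X Z) p = 0"
  shows "l = 2 * real n - 1" "m = 1"
proof -
  fix p :: 'm
  obtain B N where "finite B" "independent B" and B: "span B = tangent_space A p"
      and "card B = 2 * n + 1" and N: "N \<subseteq> B" "card N = n" "\<forall>w\<in>N. g p w w = -1"
    by (rule tangent_basis[of p])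
  \<comment> \<open>Here n \<ge> 1 enters: it provides a vector of square -1.\<close>
  have "N \<noteq> {}" using n N(2) by auto
  then obtain w where "w \<in> N" by blast
  then have w: "w \<in> tangent_space A p" "g p w w = -1"
    using B N span_superset[of B] by auto
  obtain X where X: "X \<in> vector_fields A" "X p = w" by (rule tangent_extension[OF w(1)])
  let ?W = "curvature A D \<xi> X \<xi>"
  have W: "?W \<in> vector_fields A" by (rule curvature_field[OF xi_field X(1) xi_field])
  have Wp: "?W p = w - \<eta> p w *\<^sub>R \<xi> p"
    using curvature_xi[OF xi_field X(1), of p] by (simp add: X(2) eta_xi)
  have xi: "\<xi> p \<in> tangent_space A p" "\<eta> p w *\<^sub>R \<xi> p \<in> tangent_space A p"
    by (intro subspace_scale[OF subspace_tangent_space] vector_fieldsD(1) xi_field)+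
  have eta_W: "\<eta> p (?W p) = 0"
    using linear_on_diff[OF eta_linear subspace_tangent_space w(1) xi(2)]
      linear_onD(2)[OF eta_linear xi(1)] by (simp add: Wp eta_xi)
  \<comment> \<open>This is g(w, w) - \<eta>(w)^2. With g(w, w) = -1 it is negative whatever
    \<eta>(w) is; a vector of square 1 could make it vanish.\<close>
  have g_W: "g p w (?W p) = - 1 - (\<eta> p w)\<^sup>2"
    using metric_diff_right[OF w(1) w(1) xi(2)] linear_onD(2)[OF metric_linear[OF w(1)] xi(1)]
      metric_xi[OF X(1), of p] by (simp add: Wp w(2) X(2) power2_eq_square)
  \<comment> \<open>The hypothesis is used for the triple (X, X, \<xi>). Its first term is -2n
    \<eta>(R(\<xi>, X)X), rewritten by \<open>eta_curvature_xi\<close>.\<close>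
  have "ricci A D (curvature A D \<xi> X X) \<xi> p = 2 * real n * g p w (?W p)"
    using ricci_xi[OF curvature_field[OF xi_field X(1) X(1)], of p] eta_curvature_xi[OF X(1) X(1), of p]
    by (simp add: X(2))
  \<comment> \<open>Since \<eta>(\<open>?W\<close>) = 0 at p, the term with \<mu> drops out and only
    \<lambda> remains.\<close>
  moreover have "ricci A D X ?W p = - (1 + l) * g p w (?W p)"
    using ricci_eta_soliton[OF sol X(1) W, of p] by (simp add: eta_W X(2))
  ultimately have "(2 * real n - (1 + l)) * g p w (?W p) = 0"
    using R[OF X(1) X(1) xi_field, of p] by (simp add: algebra_simps)
  moreover have "g p w (?W p) \<noteq> 0"
    using zero_le_power2[of "\<eta> p w"] unfolding g_W by linarith
  ultimately show l: "l = 2 * real n - 1" by simp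
  \<comment> \<open>S(\<xi>, \<xi>) computed twice: by the trace and by the soliton
    equation.\<close>
  have "- 2 * real n = - (1 + l) + (1 - m)"
    using ricci_xi[OF xi_field, of p] ricci_eta_soliton[OF sol xi_field xi_field, of p]
      metric_xi[OF xi_field, of p] by (simp add: eta_xi)
  then show "m = 1" using l by simp
qed

end

theorem theorem3p8:
  fixes A :: "('m::{t2_space,second_countable_topology}, 'e::euclidean_space) chart set"
    and n :: nat
    and \<phi> :: "'m \<Rightarrow> 'm tangent \<Rightarrow> 'm tangent"
    and \<xi> :: "'m vfield"
    and \<eta> :: "'m \<Rightarrow> 'm tangent \<Rightarrow> real"
    and g :: "'m \<Rightarrow> 'm tangent \<Rightarrow> 'm tangent \<Rightarrow> real"
    and D :: "'m vfield \<Rightarrow> 'm vfield \<Rightarrow> 'm vfield"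
    and l m :: real
  assumes "n \<ge> 1"
    and "DIM('e) = 2 * n + 1"
    and "smooth_atlas A"
    and "para_kenmotsu A n \<phi> \<xi> \<eta> g D"
    and "eta_ricci_soliton A \<eta> D g \<xi> l m"
    and "\<forall>X\<in>vector_fields A. \<forall>Y\<in>vector_fields A. \<forall>Z\<in>vector_fields A. \<forall>p.
           ricci A D (curvature A D \<xi> X Y) Z p + ricci A D Y (curvature A D \<xi> X Z) p = 0"
  shows "m = 1 \<and> l = 2 * real n - 1 \<and> einstein A g D"
proof -
  interpret para_kenmotsu_manifold A n \<phi> \<xi> \<eta> g D
    using assms(2-4) by unfold_locales
  note constants = eta_soliton_constants[OF assms(1,5) assms(6)[rule_format]]
  \<comment> \<open>With \<mu> = 1 the \<eta> \<otimes> \<eta> term vanishes, and -(1 + \<lambda>) =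
    -2n is the Einstein constant.\<close>
  have "einstein A g D"
    using constants ricci_eta_soliton[OF assms(5)] unfolding einstein_def by (intro exI[of _ "- 2 * real n"]) simp
  with constants show ?thesis by simp
qed

end
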